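(* Let $(S,* )$ be an adequate partial semigroup, let $k\in\mathbb{N}$, and let $A$ be a $2k$-CR set in $S$. Then $A\times A$ is a $k$-CR set in $S\times S$. In particular, if $A$ is a CR set in $S$, then $A\times A$ is a CR set in $S\times S$.
   Context: A partial semigroup is a pair $(S,* )$ where $S$ is a nonempty set and $*$ is an operation defined on a nonempty subset of $S\times S$ such that for all $x,y,z\in S$, $(x*y)*z=x*(y*z)$ in the sense that if either side is defined then so is the other and they are equal. $S\times S$ is the partial semigroup with $(a,b)*(c,d)=(a*c,b*d)$ defined iff $a*c$ and $b*d$ are both defined. For $a\in S$, $\varphi(a)=\{b\in S: a*b \text{ is defined}\}$; for finite nonempty $F\subseteq S$, $\sigma(F)=\bigcap_{a\in F}\varphi(a)$. $(S,* )$ is adequate if $\sigma(F)\neq\emptyset$ for all finite nonempty $F$. $\mathcal{P}_f(X)$ denotes the set of finite nonempty subsets of $X$. Products $\prod_{t\in H}f(t)$ are computed in increasing order of indices. In an adequate partial semigroup $S$, a sequence $f:\mathbb{N}\to S$ is adequate if (i) for each $H\in\mathcal{P}_f(\mathbb{N})$, $\prod_{t\in H}f(t)$ is defined, and (ii) for each $F\in\mathcal{P}_f(S)$ there is $m\in\mathbb{N}$ such that $\prod_{t\in H}f(t)\in\sigma(F)$ for all $H\in\mathcal{P}_f(\mathbb{N})$ with $\min H\geq m$. $\mathcal{T}_S$ denotes the set of adequate sequences in $S$, and $\mathcal{P}_f(\mathcal{T}_S)_{\leq k}=\{F\in\mathcal{P}_f(\mathcal{T}_S): |F|\leq k\}$.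 For $k\in\mathbb{N}$, $A\subseteq S$ is a $k$-CR set in $S$ if for every $L\in\mathcal{P}_f(S)$ there is $r\in\mathbb{N}$ such that for every $F\in\mathcal{P}_f(\mathcal{T}_S)_{\leq k}$ there exist $m\in\mathbb{N}$, $a\in S^{m+1}$ and $t(1)<\dots<t(m)\leq r$ in $\mathbb{N}$ such that for all $f\in F$, $a(1)*f(t(1))*a(2)*\dots*a(m)*f(t(m))*a(m+1)$ is defined and lies in $A\cap\sigma(L)$; $A$ is a CR set if it is $k$-CR for all $k$. (The same definitions apply in $S\times S$.) *)

theory Defs
  imports Main "HOL-Library.FuncSet"
begin

text \<open>
  A partial operation on a carrier \<open>S\<close> is a function into \<open>'a option\<close>, with \<open>None\<close> for
  ``undefined''. Its values outside the carrier are never inspected. The positive integers are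
  rendered as \<open>{1..} :: nat set\<close>.
\<close>

definition partial_semigroup :: "'a set \<Rightarrow> ('a \<Rightarrow> 'a \<Rightarrow> 'a option) \<Rightarrow> bool" where
  "partial_semigroup S m \<longleftrightarrow>
     S \<noteq> {} \<and>
     (\<exists>x\<in>S. \<exists>y\<in>S. m x y \<noteq> None) \<and>
     (\<forall>x\<in>S. \<forall>y\<in>S. \<forall>z. m x y = Some z \<longrightarrow> z \<in> S) \<and>
     (\<forall>x\<in>S. \<forall>y\<in>S. \<forall>z\<in>S.
        Option.bind (m x y) (\<lambda>u. m u z) = Option.bind (m y z) (\<lambda>v. m x v))"

definition times_op ::
    "('a \<Rightarrow> 'a \<Rightarrow> 'a option) \<Rightarrow> ('b \<Rightarrow> 'b \<Rightarrow> 'b option) \<Rightarrow> 'a \<times> 'b \<Rightarrow> 'a \<times> 'b \<Rightarrow> ('a \<times> 'b) option" where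
  "times_op m n p q =
     Option.bind (m (fst p) (fst q)) (\<lambda>x. Option.bind (n (snd p) (snd q)) (\<lambda>y. Some (x, y)))"

definition phi :: "'a set \<Rightarrow> ('a \<Rightarrow> 'a \<Rightarrow> 'a option) \<Rightarrow> 'a \<Rightarrow> 'a set" where
  "phi S m a = {b \<in> S. m a b \<noteq> None}"

text \<open>Only meaningful for nonempty \<open>F\<close>, which is how it is always used.\<close>

definition sigma :: "'a set \<Rightarrow> ('a \<Rightarrow> 'a \<Rightarrow> 'a option) \<Rightarrow> 'a set \<Rightarrow> 'a set" where
  "sigma S m F = (\<Inter>a\<in>F. phi S m a)"

definition Pf :: "'a set \<Rightarrow> 'a set set" where
  "Pf X = {F. F \<subseteq> X \<and> finite F \<and> F \<noteq> {}}"

definition Pf_le :: "nat \<Rightarrow> 'a set \<Rightarrow> 'a set set" where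
  "Pf_le k X = {F \<in> Pf X. card F \<le> k}"

definition adequate_partial_semigroup :: "'a set \<Rightarrow> ('a \<Rightarrow> 'a \<Rightarrow> 'a option) \<Rightarrow> bool" where
  "adequate_partial_semigroup S m \<longleftrightarrow>
     partial_semigroup S m \<and> (\<forall>F\<in>Pf S. sigma S m F \<noteq> {})"

text \<open>
  The product of a nonempty word, \<open>None\<close> if undefined. By associativity the choice of bracketing
  is immaterial, see \<open>word_prod_append\<close> below. Empty words never occur.
\<close>

fun word_prod :: "('a \<Rightarrow> 'a \<Rightarrow> 'a option) \<Rightarrow> 'a list \<Rightarrow> 'a option" where
  "word_prod m [] = None"
| "word_prod m [x] = Some x"
| "word_prod m (x # y # ys) = Option.bind (word_prod m (y # ys)) (m x)"

definition seq_prod :: "('a \<Rightarrow> 'a \<Rightarrow> 'a option) \<Rightarrow> (nat \<Rightarrow> 'a) \<Rightarrow> nat set \<Rightarrow> 'a option" where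
  "seq_prod m f H = word_prod m (map f (sorted_list_of_set H))"

text \<open>
  The set of adequate sequences. Sequences are extensional functions on the positive integers, so
  that two of them are equal iff they agree there; this matters for counting them.
\<close>

definition adequate_seqs :: "'a set \<Rightarrow> ('a \<Rightarrow> 'a \<Rightarrow> 'a option) \<Rightarrow> (nat \<Rightarrow> 'a) set" where
  "adequate_seqs S m = {f \<in> {1..} \<rightarrow>\<^sub>E S.
     (\<forall>H\<in>Pf {1..}. seq_prod m f H \<noteq> None) \<and>
     (\<forall>F\<in>Pf S. \<exists>l\<ge>1. \<forall>H\<in>Pf {1..}. Min H \<ge> l \<longrightarrow>
        (\<exists>p\<in>sigma S m F. seq_prod m f H = Some p))}"

text \<open>The word \<open>a(1) f(t(1)) a(2) \<dots> a(n) f(t(n)) a(n+1)\<close>.\<close>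

definition interleave :: "nat \<Rightarrow> (nat \<Rightarrow> 'a) \<Rightarrow> (nat \<Rightarrow> nat) \<Rightarrow> (nat \<Rightarrow> 'a) \<Rightarrow> 'a list" where
  "interleave n a t f = concat (map (\<lambda>i. [a i, f (t i)]) [1..<n+1]) @ [a (n+1)]"

definition k_CR_set :: "nat \<Rightarrow> 'a set \<Rightarrow> ('a \<Rightarrow> 'a \<Rightarrow> 'a option) \<Rightarrow> 'a set \<Rightarrow> bool" where
  "k_CR_set k S m A \<longleftrightarrow> A \<subseteq> S \<and>
     (\<forall>L\<in>Pf S. \<exists>r\<ge>1. \<forall>F\<in>Pf_le k (adequate_seqs S m).
        \<exists>n\<ge>1. \<exists>a\<in>{1..n+1} \<rightarrow> S. \<exists>t\<in>{1..n} \<rightarrow> {1..r}. strict_mono_on {1..n} t \<and>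
          (\<forall>f\<in>F. \<exists>p\<in>A \<inter> sigma S m L. word_prod m (interleave n a t f) = Some p))"

definition CR_set :: "'a set \<Rightarrow> ('a \<Rightarrow> 'a \<Rightarrow> 'a option) \<Rightarrow> 'a set \<Rightarrow> bool" where
  "CR_set S m A \<longleftrightarrow> (\<forall>k\<ge>1. k_CR_set k S m A)"

lemma partial_semigroup_assoc:
  assumes "partial_semigroup S m" "x \<in> S" "y \<in> S" "z \<in> S"
  shows "Option.bind (m x y) (\<lambda>u. m u z) = Option.bind (m y z) (\<lambda>v. m x v)"
  using assms unfolding partial_semigroup_def by blast

lemma partial_semigroup_closed:
  assumes "partial_semigroup S m" "x \<in> S" "y \<in> S" "m x y = Some z"
  shows "z \<in> S"
  using assms unfolding partial_semigroup_def by blast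

lemma word_prod_in_carrier:
  assumes "partial_semigroup S m" "set xs \<subseteq> S" "word_prod m xs = Some p"
  shows "p \<in> S"
  using assms(2,3)
proof (induction xs arbitrary: p)
  case (Cons x xs)
  show ?case
  proof (cases xs)
    case Nil
    with Cons.prems show ?thesis by simp
  next
    case (Cons y ys)
    with Cons.prems obtain q where "word_prod m xs = Some q" "m x q = Some p"
      by (auto simp: bind_eq_Some_conv)
    with Cons.IH Cons.prems show ?thesis
      by (auto intro: partial_semigroup_closed[OF assms(1)])
  qed
qed simp

lemma word_prod_append:
  assumes "partial_semigroup S m" "xs \<noteq> []" "ys \<noteq> []" "set xs \<subseteq> S" "set ys \<subseteq> S"
  shows "word_prod m (xs @ ys) =
    Option.bind (word_prod m xs) (\<lambda>p. Option.bind (word_prod m ys) (\<lambda>q. m p q))"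
  using assms(2,4)
proof (induction xs)
  case (Cons x xs)
  obtain y' ys' where ys: "ys = y' # ys'"
    using assms(3) by (cases ys) auto
  show ?case
  proof (cases xs)
    case Nil
    then show ?thesis by (simp add: ys)
  next
    case (Cons y zs)
    have IH: "word_prod m (xs @ ys) =
        Option.bind (word_prod m xs) (\<lambda>p. Option.bind (word_prod m ys) (\<lambda>q. m p q))"
      using Cons Cons.IH Cons.prems by simp
    have assoc: "Option.bind (m x p) (\<lambda>u. m u q) = Option.bind (m p q) (\<lambda>v. m x v)"
      if "word_prod m xs = Some p" "word_prod m ys = Some q" for p q
    proof -
      have "p \<in> S" "q \<in> S" "x \<in> S"
        using that word_prod_in_carrier[OF assms(1)] assms(5) Cons.prems by auto
      then show ?thesis
        by (intro partial_semigroup_assoc[OF assms(1)])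
    qed
    have "word_prod m ((x # xs) @ ys) = Option.bind (word_prod m (xs @ ys)) (m x)"
      by (simp add: Cons)
    also have "\<dots> = Option.bind (Option.bind (word_prod m xs) (m x))
        (\<lambda>p. Option.bind (word_prod m ys) (\<lambda>q. m p q))"
    proof (cases "word_prod m xs")
      case None
      then show ?thesis by (simp add: IH)
    next
      case p: (Some p)
      show ?thesis
      proof (cases "word_prod m ys")
        case None
        then show ?thesis by (cases "m x p") (simp_all add: IH p)
      next
        case q: (Some q)
        show ?thesis using assoc[OF p q] by (simp add: IH p q)
      qed
    qed
    also have "Option.bind (word_prod m xs) (m x) = word_prod m (x # xs)"
      by (simp add: Cons)
    finally show ?thesis .
  qed
qed simp

lemma adequate_partial_semigroup_Times:
  assumes S: "adequate_partial_semigroup S m" and T: "adequate_partial_semigroup T n"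
  shows "adequate_partial_semigroup (S \<times> T) (times_op m n)"
proof -
  have s: "partial_semigroup S m" and t: "partial_semigroup T n"
    using S T by (auto simp: adequate_partial_semigroup_def)
  obtain x y x' y' where ex: "x \<in> S" "y \<in> S" "m x y \<noteq> None"
      "x' \<in> T" "y' \<in> T" "n x' y' \<noteq> None"
    using s t unfolding partial_semigroup_def by blast
  have "\<exists>p\<in>S \<times> T. \<exists>q\<in>S \<times> T. times_op m n p q \<noteq> None"
    using ex by (intro bexI[of _ "(x, x')"] bexI[of _ "(y, y')"]) (auto simp: times_op_def)
  moreover have "z \<in> S \<times> T"
    if "p \<in> S \<times> T" "q \<in> S \<times> T" and z: "times_op m n p q = Some z" for p q z
  proof -
    obtain u v where "m (fst p) (fst q) = Some u" "n (snd p) (snd q) = Some v" "z = (u, v)"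
      using z by (auto simp: times_op_def bind_eq_Some_conv)
    moreover have "fst p \<in> S" "fst q \<in> S" "snd p \<in> T" "snd q \<in> T"
      using that by auto
    ultimately show ?thesis
      using partial_semigroup_closed[OF s] partial_semigroup_closed[OF t] by blast
  qed
  moreover have "Option.bind (times_op m n p q) (\<lambda>u. times_op m n u r) =
      Option.bind (times_op m n q r) (\<lambda>v. times_op m n p v)"
    if "p \<in> S \<times> T" "q \<in> S \<times> T" "r \<in> S \<times> T" for p q r
  proof -
    have "Option.bind (m (fst p) (fst q)) (\<lambda>u. m u (fst r)) =
          Option.bind (m (fst q) (fst r)) (\<lambda>v. m (fst p) v)"
      using that by (intro partial_semigroup_assoc[OF s]) auto
    moreover have "Option.bind (n (snd p) (snd q)) (\<lambda>u. n u (snd r)) =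
          Option.bind (n (snd q) (snd r)) (\<lambda>v. n (snd p) v)"
      using that by (intro partial_semigroup_assoc[OF t]) auto
    ultimately show ?thesis
      unfolding times_op_def
      by (cases "m (fst p) (fst q)"; cases "m (fst q) (fst r)";
          cases "n (snd p) (snd q)"; cases "n (snd q) (snd r)"; simp)
  qed
  moreover have "S \<times> T \<noteq> {}"
    using ex by auto
  ultimately have "partial_semigroup (S \<times> T) (times_op m n)"
    unfolding partial_semigroup_def by (intro conjI ballI allI impI)
  moreover have "sigma (S \<times> T) (times_op m n) F \<noteq> {}" if F: "F \<in> Pf (S \<times> T)" for F
  proof -
    have "fst ` F \<in> Pf S" "snd ` F \<in> Pf T"
      using F by (auto simp: Pf_def)
    then obtain b c where "b \<in> sigma S m (fst ` F)" "c \<in> sigma T n (snd ` F)"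
      using S T unfolding adequate_partial_semigroup_def by blast
    then have "(b, c) \<in> sigma (S \<times> T) (times_op m n) F"
      by (fastforce simp: sigma_def phi_def times_op_def)
    then show ?thesis by blast
  qed
  ultimately show ?thesis
    by (simp add: adequate_partial_semigroup_def)
qed

end

theory Submission
  imports Defs
begin

text \<open>
  The coordinates of adequate sequences in \<open>S \<times> S\<close> are adequate sequences in \<open>S\<close>, so at most \<open>k\<close> of
  the former give at most \<open>2k\<close> of the latter. A common choice of \<open>a\<close> and \<open>t\<close> for these, with \<open>a\<close>
  repeated in both coordinates, works in \<open>S \<times> S\<close>, since products there are computed coordinatewise.
\<close>

text \<open>The two-step induction follows the recursion of \<open>word_prod\<close>. A product of
  pairs is defined exactly when both coordinate products are, and on the empty word both sides are
  \<open>None\<close>.\<close>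

lemma word_prod_times_op:
  "word_prod (times_op m n) xs =
     Option.bind (word_prod m (map fst xs)) (\<lambda>x.
       Option.bind (word_prod n (map snd xs)) (\<lambda>y. Some (x, y)))"
proof (induction xs rule: induct_list012)
  case (3 x y zs)
  then show ?case
    by (cases "word_prod m (map fst (y # zs))"; cases "word_prod n (map snd (y # zs))")
       (simp_all add: times_op_def)
qed simp_all

lemma word_prod_times_op_eq_Some_iff:
  "word_prod (times_op m n) xs = Some p \<longleftrightarrow>
     word_prod m (map fst xs) = Some (fst p) \<and> word_prod n (map snd xs) = Some (snd p)"
  by (cases p) (auto simp: word_prod_times_op bind_eq_Some_conv)

text \<open>Members of \<open>adequate_seqs\<close> are extensional, so a coordinate sequence has to
  be cut down to the positive integers. Index sets in \<open>Pf {1..}\<close> never see the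
  difference.\<close>

lemma seq_prod_restrict:
  assumes "H \<in> Pf {1..}"
  shows "seq_prod m (restrict f {1..}) H = seq_prod m f H"
proof -
  have "map (restrict f {1..}) (sorted_list_of_set H) = map f (sorted_list_of_set H)"
    using assms by (intro map_cong) (auto simp: Pf_def)
  then show ?thesis
    by (simp only: seq_prod_def)
qed

lemma seq_prod_times_op_eq_Some_iff:
  "seq_prod (times_op m n) f H = Some p \<longleftrightarrow>
     seq_prod m (\<lambda>i. fst (f i)) H = Some (fst p) \<and> seq_prod n (\<lambda>i. snd (f i)) H = Some (snd p)"
  by (simp add: seq_prod_def word_prod_times_op_eq_Some_iff comp_def)

text \<open>This lets a tail condition with a rectangular target be split into one condition per
  coordinate.\<close>

lemma bex_seq_prod_times_op_iff:
  "(\<exists>p\<in>A \<times> B. seq_prod (times_op m n) f H = Some p) \<longleftrightarrow>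
     (\<exists>x\<in>A. seq_prod m (\<lambda>i. fst (f i)) H = Some x) \<and>
     (\<exists>y\<in>B. seq_prod n (\<lambda>i. snd (f i)) H = Some y)"
  by (auto simp: seq_prod_times_op_eq_Some_iff)

text \<open>Definedness is coordinatewise, so \<open>phi\<close> of a pair is a rectangle, and an
  intersection of rectangles is the rectangle of the intersections.\<close>

lemma sigma_times_op:
  assumes "L \<noteq> {}"
  shows "sigma (S \<times> T) (times_op m n) L = sigma S m (fst ` L) \<times> sigma T n (snd ` L)"
  using assms by (fastforce simp: sigma_def phi_def times_op_def bind_eq_None_conv)

lemma sigma_antimono: "L \<subseteq> L' \<Longrightarrow> sigma S m L' \<subseteq> sigma S m L"
  by (auto simp: sigma_def)

lemma adequate_seqs_tail:
  assumes "f \<in> adequate_seqs S m" "F \<in> Pf S"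
  shows "\<exists>l\<ge>1. \<forall>H\<in>Pf {1..}. Min H \<ge> l \<longrightarrow> (\<exists>p\<in>sigma S m F. seq_prod m f H = Some p)"
  using assms unfolding adequate_seqs_def by blast

lemma adequate_seqs_fst:
  assumes f: "f \<in> adequate_seqs (S \<times> T) (times_op m n)" and "T \<noteq> {}"
  shows "(\<lambda>i\<in>{1..}. fst (f i)) \<in> adequate_seqs S m"
proof -
  obtain y where y: "y \<in> T"
    using assms by blast
  have "\<exists>l\<ge>1. \<forall>H\<in>Pf {1..}. Min H \<ge> l \<longrightarrow>
      (\<exists>p\<in>sigma S m F. seq_prod m (\<lambda>i. fst (f i)) H = Some p)" if F: "F \<in> Pf S" for F
  proof -
    \<comment> \<open>Tail conditions for \<open>f\<close> concern sets of pairs. Attaching a fixed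
      second coordinate to \<open>F\<close> gives such a set with first projection
      \<open>F\<close>.\<close>
    have *: "F \<times> {y} \<in> Pf (S \<times> T)" and ne: "F \<times> {y} \<noteq> {}" and fst: "fst ` (F \<times> {y}) = F"
      using F y by (auto simp: Pf_def)
    have "\<exists>l\<ge>1. \<forall>H\<in>Pf {1..}. Min H \<ge> l \<longrightarrow>
        (\<exists>p\<in>sigma S m F \<times> sigma T n (snd ` (F \<times> {y})). seq_prod (times_op m n) f H = Some p)"
      using adequate_seqs_tail[OF f *] unfolding sigma_times_op[OF ne] fst .
    then show ?thesis
      unfolding bex_seq_prod_times_op_iff by blast
  qed
  moreover have "seq_prod m (\<lambda>i. fst (f i)) H \<noteq> None" if "H \<in> Pf {1..}" for H
    using f that by (auto simp: adequate_seqs_def seq_prod_times_op_eq_Some_iff)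
  moreover have "(\<lambda>i\<in>{1..}. fst (f i)) \<in> {1..} \<rightarrow>\<^sub>E S"
    using f by (auto simp: adequate_seqs_def PiE_def Pi_def mem_Times_iff)
  ultimately show ?thesis
    \<comment> \<open>With \<open>One_nat_def\<close> active, \<open>{1..}\<close> would become
      \<open>{Suc 0..}\<close> and \<open>seq_prod_restrict\<close> would not match.\<close>
    by (simp add: adequate_seqs_def seq_prod_restrict del: One_nat_def)
qed

text \<open>Mirror image of \<open>adequate_seqs_fst\<close>: here a fixed first coordinate from
  \<open>S\<close> is attached to \<open>F\<close>.\<close>

lemma adequate_seqs_snd:
  assumes f: "f \<in> adequate_seqs (S \<times> T) (times_op m n)" and "S \<noteq> {}"
  shows "(\<lambda>i\<in>{1..}. snd (f i)) \<in> adequate_seqs T n"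
proof -
  obtain x where x: "x \<in> S"
    using assms by blast
  have "\<exists>l\<ge>1. \<forall>H\<in>Pf {1..}. Min H \<ge> l \<longrightarrow>
      (\<exists>p\<in>sigma T n F. seq_prod n (\<lambda>i. snd (f i)) H = Some p)" if F: "F \<in> Pf T" for F
  proof -
    have *: "{x} \<times> F \<in> Pf (S \<times> T)" and ne: "{x} \<times> F \<noteq> {}" and snd: "snd ` ({x} \<times> F) = F"
      using F x by (auto simp: Pf_def)
    have "\<exists>l\<ge>1. \<forall>H\<in>Pf {1..}. Min H \<ge> l \<longrightarrow>
        (\<exists>p\<in>sigma S m (fst ` ({x} \<times> F)) \<times> sigma T n F. seq_prod (times_op m n) f H = Some p)"
      using adequate_seqs_tail[OF f *] unfolding sigma_times_op[OF ne] snd .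
    then show ?thesis
      unfolding bex_seq_prod_times_op_iff by blast
  qed
  moreover have "seq_prod n (\<lambda>i. snd (f i)) H \<noteq> None" if "H \<in> Pf {1..}" for H
    using f that by (auto simp: adequate_seqs_def seq_prod_times_op_eq_Some_iff)
  moreover have "(\<lambda>i\<in>{1..}. snd (f i)) \<in> {1..} \<rightarrow>\<^sub>E T"
    using f by (auto simp: adequate_seqs_def PiE_def Pi_def mem_Times_iff)
  ultimately show ?thesis
    by (simp add: adequate_seqs_def seq_prod_restrict del: One_nat_def)
qed

lemma map_interleave: "map g (interleave n a t f) = interleave n (\<lambda>i. g (a i)) t (\<lambda>i. g (f i))"
  by (simp add: interleave_def map_concat comp_def)

text \<open>The word evaluates \<open>f\<close> only at the values \<open>t i\<close> with
  \<open>i\<close> in \<open>{1..n}\<close>, and these are positive.\<close>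

lemma interleave_restrict:
  assumes "t \<in> {1..n} \<rightarrow> {1..}"
  shows "interleave n a t (restrict f {1..}) = interleave n a t f"
  unfolding interleave_def using assms
  by (intro arg_cong2[of _ _ _ _ "(@)"] arg_cong[of _ _ concat] map_cong) (auto simp: Pi_iff)

lemma k_CR_setD:
  assumes "k_CR_set k S m A" "L \<in> Pf S"
  obtains r where "r \<ge> 1" "\<And>F. F \<in> Pf_le k (adequate_seqs S m) \<Longrightarrow>
    \<exists>n\<ge>1. \<exists>a\<in>{1..n+1} \<rightarrow> S. \<exists>t\<in>{1..n} \<rightarrow> {1..r}. strict_mono_on {1..n} t \<and>
      (\<forall>f\<in>F. \<exists>p\<in>A \<inter> sigma S m L. word_prod m (interleave n a t f) = Some p)"
proof -
  have "\<exists>r\<ge>1. \<forall>F\<in>Pf_le k (adequate_seqs S m).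
      \<exists>n\<ge>1. \<exists>a\<in>{1..n+1} \<rightarrow> S. \<exists>t\<in>{1..n} \<rightarrow> {1..r}. strict_mono_on {1..n} t \<and>
        (\<forall>f\<in>F. \<exists>p\<in>A \<inter> sigma S m L. word_prod m (interleave n a t f) = Some p)"
    using assms unfolding k_CR_set_def by simp
  then show ?thesis
    by (elim exE conjE) (rule that, assumption, erule bspec)
qed

lemma k_CR_set_Times:
  assumes A: "k_CR_set (2 * k) S m A" and S: "S \<noteq> {}"
  shows "k_CR_set k (S \<times> S) (times_op m m) (A \<times> A)"
proof -
  have "\<exists>r\<ge>1. \<forall>F\<in>Pf_le k (adequate_seqs (S \<times> S) (times_op m m)).
      \<exists>n\<ge>1. \<exists>a\<in>{1..n+1} \<rightarrow> S \<times> S. \<exists>t\<in>{1..n} \<rightarrow> {1..r}. strict_mono_on {1..n} t \<and>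
        (\<forall>f\<in>F. \<exists>p\<in>A \<times> A \<inter> sigma (S \<times> S) (times_op m m) L.
          word_prod (times_op m m) (interleave n a t f) = Some p)"
    if L: "L \<in> Pf (S \<times> S)" for L
  proof -
    \<comment> \<open>Both projections are merged because the hypothesis on \<open>A\<close> handles
      one finite set at a time. The bound \<open>r\<close> obtained from \<open>L'\<close> is then
      fixed before \<open>F\<close> is given.\<close>
    define L' where "L' = fst ` L \<union> snd ` L"
    have "L' \<in> Pf S"
      using L by (auto simp: Pf_def L'_def)
    then obtain r where "r \<ge> 1" and r: "\<And>G. G \<in> Pf_le (2 * k) (adequate_seqs S m) \<Longrightarrow>
        \<exists>n\<ge>1. \<exists>a\<in>{1..n+1} \<rightarrow> S. \<exists>t\<in>{1..n} \<rightarrow> {1..r}. strict_mono_on {1..n} t \<and>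
          (\<forall>f\<in>G. \<exists>p\<in>A \<inter> sigma S m L'. word_prod m (interleave n a t f) = Some p)"
      by (rule k_CR_setD[OF A]) blast
    \<comment> \<open>\<open>sigma\<close> reverses inclusions, so \<open>sigma S m L'\<close> lies
      in the \<open>sigma\<close> set of either projection of \<open>L\<close>.\<close>
    have sigma_L: "sigma S m L' \<times> sigma S m L' \<subseteq> sigma (S \<times> S) (times_op m m) L"
    proof -
      have "L \<noteq> {}"
        using L by (simp add: Pf_def)
      then show ?thesis
        unfolding sigma_times_op[OF \<open>L \<noteq> {}\<close>] L'_def
        by (intro Sigma_mono sigma_antimono) auto
    qed
    have "\<exists>n\<ge>1. \<exists>a\<in>{1..n+1} \<rightarrow> S \<times> S. \<exists>t\<in>{1..n} \<rightarrow> {1..r}. strict_mono_on {1..n} t \<and>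
        (\<forall>f\<in>F. \<exists>p\<in>A \<times> A \<inter> sigma (S \<times> S) (times_op m m) L.
          word_prod (times_op m m) (interleave n a t f) = Some p)"
      if F: "F \<in> Pf_le k (adequate_seqs (S \<times> S) (times_op m m))" for F
    proof -
      define G1 where "G1 = (\<lambda>f. \<lambda>i\<in>{1..}. fst (f i)) ` F"
      define G2 where "G2 = (\<lambda>f. \<lambda>i\<in>{1..}. snd (f i)) ` F"
      have fin: "finite F" and "F \<noteq> {}" and sub: "F \<subseteq> adequate_seqs (S \<times> S) (times_op m m)"
        and "card F \<le> k"
        using F by (auto simp: Pf_le_def Pf_def)
      \<comment> \<open>Distinct members of \<open>F\<close> may share a coordinate, and
        \<open>G1\<close> and \<open>G2\<close> may overlap; both effects only lower the
        count.\<close>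
      have "card (G1 \<union> G2) \<le> 2 * k"
        using card_Un_le[of G1 G2] card_image_le[OF fin] \<open>card F \<le> k\<close>
        unfolding G1_def G2_def by (smt (verit) add_mono mult_2 order_trans)
      moreover have "G1 \<union> G2 \<subseteq> adequate_seqs S m"
        using sub S adequate_seqs_fst adequate_seqs_snd unfolding G1_def G2_def by blast
      moreover have "finite (G1 \<union> G2)" "G1 \<union> G2 \<noteq> {}"
        using fin \<open>F \<noteq> {}\<close> by (auto simp: G1_def G2_def)
      ultimately have "G1 \<union> G2 \<in> Pf_le (2 * k) (adequate_seqs S m)"
        by (simp add: Pf_le_def Pf_def)
      \<comment> \<open>Applying \<open>r\<close> once to the union, not separately to
        \<open>G1\<close> and \<open>G2\<close>, forces the same \<open>n\<close> and
        \<open>t\<close> in both coordinates.\<close>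
      from r[OF this] obtain n a t where "n \<ge> 1" and a: "a \<in> {1..n+1} \<rightarrow> S"
        and t: "t \<in> {1..n} \<rightarrow> {1..r}" and mono: "strict_mono_on {1..n} t"
        and prod: "\<And>f. f \<in> G1 \<union> G2 \<Longrightarrow>
          \<exists>p\<in>A \<inter> sigma S m L'. word_prod m (interleave n a t f) = Some p"
        by (elim exE conjE bexE) blast
      have t1: "t \<in> {1..n} \<rightarrow> {1..}"
        using t by (auto simp: Pi_iff)
      \<comment> \<open>Either projection of the diagonal word \<open>(a i, a i)\<close> gives back
        \<open>a\<close>, so the two coordinate words are those of \<open>prod\<close>. Their values
        \<open>p\<close> and \<open>q\<close> may differ, which the rectangle
        \<open>A \<times> A\<close> permits.\<close>
      have "\<exists>p\<in>A \<times> A \<inter> sigma (S \<times> S) (times_op m m) L.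
          word_prod (times_op m m) (interleave n (\<lambda>i. (a i, a i)) t f) = Some p"
        if "f \<in> F" for f
      proof -
        obtain p where p: "p \<in> A \<inter> sigma S m L'"
            "word_prod m (interleave n a t (\<lambda>i. fst (f i))) = Some p"
          using prod[of "\<lambda>i\<in>{1..}. fst (f i)"] \<open>f \<in> F\<close>
          unfolding G1_def interleave_restrict[OF t1] by blast
        obtain q where q: "q \<in> A \<inter> sigma S m L'"
            "word_prod m (interleave n a t (\<lambda>i. snd (f i))) = Some q"
          using prod[of "\<lambda>i\<in>{1..}. snd (f i)"] \<open>f \<in> F\<close>
          unfolding G2_def interleave_restrict[OF t1] by blast
        show ?thesis
          using p q sigma_L
          by (intro bexI[of _ "(p, q)"]) (auto simp: word_prod_times_op_eq_Some_iff map_interleave)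
      qed
      moreover have "(\<lambda>i. (a i, a i)) \<in> {1..n+1} \<rightarrow> S \<times> S"
        using a by (auto simp: Pi_iff)
      ultimately show ?thesis
        using \<open>n \<ge> 1\<close> t mono
        by (intro exI[of _ n] conjI bexI[of _ "\<lambda>i. (a i, a i)"] bexI[of _ t] ballI)
    qed
    with \<open>r \<ge> 1\<close> show ?thesis
      by - (rule exI[of _ r], rule conjI, assumption, rule ballI, blast)
  qed
  moreover have "A \<times> A \<subseteq> S \<times> S"
    using A by (auto simp: k_CR_set_def)
  ultimately show ?thesis
    unfolding k_CR_set_def by (intro conjI ballI)
qed

theorem theorem4p3:
  fixes S :: "'a set" and m :: "'a \<Rightarrow> 'a \<Rightarrow> 'a option"
  assumes "adequate_partial_semigroup S m"
  shows "(\<forall>k A. k \<ge> 1 \<longrightarrow> k_CR_set (2 * k) S m A \<longrightarrow> k_CR_set k (S \<times> S) (times_op m m) (A \<times> A)) \<and>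
         (\<forall>A. CR_set S m A \<longrightarrow> CR_set (S \<times> S) (times_op m m) (A \<times> A))"
proof -
  have "S \<noteq> {}"
    using assms by (simp add: adequate_partial_semigroup_def partial_semigroup_def)
  \<comment> \<open>For the claim about CR sets at \<open>k\<close>, the hypothesis is used at
    \<open>2 * k\<close>, which is again positive.\<close>
  then show ?thesis
    by (simp add: k_CR_set_Times CR_set_def)
qed

end
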